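(* Let $G=(V,E)$ be a connected graph on $n\ge 1$ vertices, fix $v\in V$, let $\omega$ be a proper colouring of $G$, and let $s$ be a positive integer. Suppose that, for every set $A\subset V$ such that $v\in A$ and $G[A]$ is connected, we have $|N(A)|\le s$. Then $$m^{(v)}(G,\omega)\ \ge\ \frac{1}{s}(n-1).$$
   Context: All graphs are finite and simple. $G[A]$ is the subgraph induced by $A$, and $N(A)$ is the set of vertices of $V\setminus A$ having at least one neighbour in $A$. The fixed Flood-It game with pivot $v$: let $G=(V,E)$ be a graph with a colouring $\omega:V\to C$, where $C$ is a finite colour-set. A monochromatic component is a maximal set of vertices of one colour inducing a connected subgraph. A move consists of a colour $d\in C$ and recolours with colour $d$ every vertex in the monochromatic component (with respect to the current colouring) containing the fixed pivot vertex $v$. For $d\in C$, $m^{(v)}(G,\omega,d)$ is the minimum number of such moves needed, starting from $\omega$, to give all vertices of $G$ colour $d$, and $m^{(v)}(G,\omega)=\min_{d\in C}m^{(v)}(G,\omega,d)$. *)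

theory Defs
  imports Complex_Main "Graph_Theory.Graph_Theory"
begin

text \<open>
  Finite simple graphs are the symmetric, loop-free digraphs without parallel arcs of the locale
  \<open>graph\<close>; \<open>G \<restriction> A\<close> is the induced subgraph. The library's \<open>connected\<close> includes
  nonemptiness of the vertex set.
\<close>

definition nbhd :: "('a, 'b) pre_digraph \<Rightarrow> 'a set \<Rightarrow> 'a set" where
  "nbhd G A = {w \<in> verts G - A. \<exists>u\<in>A. w \<rightarrow>\<^bsub>G\<^esub> u}"

definition proper_colouring :: "('a, 'b) pre_digraph \<Rightarrow> ('a \<Rightarrow> 'c) \<Rightarrow> bool" where
  "proper_colouring G \<omega> \<longleftrightarrow> (\<forall>u w. u \<rightarrow>\<^bsub>G\<^esub> w \<longrightarrow> \<omega> u \<noteq> \<omega> w)"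

definition mono_connected :: "('a, 'b) pre_digraph \<Rightarrow> ('a \<Rightarrow> 'c) \<Rightarrow> 'a set \<Rightarrow> bool" where
  "mono_connected G \<omega> A \<longleftrightarrow>
     A \<subseteq> verts G \<and> (\<exists>c. \<forall>u\<in>A. \<omega> u = c) \<and> Digraph_Component.connected (G \<restriction> A)"

definition mono_component :: "('a, 'b) pre_digraph \<Rightarrow> ('a \<Rightarrow> 'c) \<Rightarrow> 'a set \<Rightarrow> bool" where
  "mono_component G \<omega> A \<longleftrightarrow>
     mono_connected G \<omega> A \<and> (\<forall>B. mono_connected G \<omega> B \<and> A \<subseteq> B \<longrightarrow> B = A)"

definition flood_move :: "('a, 'b) pre_digraph \<Rightarrow> 'a \<Rightarrow> 'c \<Rightarrow> ('a \<Rightarrow> 'c) \<Rightarrow> ('a \<Rightarrow> 'c)" where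
  "flood_move G v d \<omega> =
     (\<lambda>u. if \<exists>A. mono_component G \<omega> A \<and> v \<in> A \<and> u \<in> A then d else \<omega> u)"

definition floods_to ::
  "('a, 'b) pre_digraph \<Rightarrow> 'a \<Rightarrow> ('a \<Rightarrow> 'c) \<Rightarrow> 'c list \<Rightarrow> 'c \<Rightarrow> bool" where
  "floods_to G v \<omega> ds d \<longleftrightarrow> (\<forall>u\<in>verts G. fold (flood_move G v) ds \<omega> u = d)"

text \<open>
  The \<open>LEAST\<close> below ranges over a nonempty set whenever \<open>G\<close> is connected, \<open>v\<close> is a vertex of \<open>G\<close>,
  \<open>\<omega>\<close> takes its values on the vertices in \<open>C\<close>, and \<open>d \<in> C\<close>: repeatedly playing the colour of a
  neighbour of the pivot's component absorbs the whole graph, and a last move gives it colour \<open>d\<close>.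
\<close>

definition min_moves_to ::
  "('a, 'b) pre_digraph \<Rightarrow> 'c set \<Rightarrow> 'a \<Rightarrow> ('a \<Rightarrow> 'c) \<Rightarrow> 'c \<Rightarrow> nat" where
  "min_moves_to G C v \<omega> d = (LEAST k. \<exists>ds. set ds \<subseteq> C \<and> length ds = k \<and> floods_to G v \<omega> ds d)"

definition min_moves ::
  "('a, 'b) pre_digraph \<Rightarrow> 'c set \<Rightarrow> 'a \<Rightarrow> ('a \<Rightarrow> 'c) \<Rightarrow> nat" where
  "min_moves G C v \<omega> = Min (min_moves_to G C v \<omega> ` C)"

end

theory Submission
  imports Defs
begin

text \<open>
  The pivot's component after some moves is a connected set \<open>B \<ni> v\<close>, outside of which the colouring
  is still the proper colouring \<open>\<omega>\<close>. Hence a move of colour \<open>d\<close> absorbs exactly the vertices of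
  \<open>N(B)\<close> of colour \<open>d\<close>: a vertex adjacent to one of these but not to \<open>B\<close> has a different colour.
  So each move adds at most \<open>|N(B)| \<le> s\<close> vertices to the component, which starts as \<open>{v}\<close> and must
  end as the whole vertex set.
\<close>

lemma adj_induce_iff: "u \<rightarrow>\<^bsub>G \<restriction> A\<^esub> w \<longleftrightarrow> u \<rightarrow>\<^bsub>G\<^esub> w \<and> u \<in> A \<and> w \<in> A"
  by (auto simp: arcs_ends_def arc_to_ends_def)

lemma (in wf_digraph) induce_verts_self: "G \<restriction> verts G = G"
  by (rule pre_digraph.equality) auto

lemma (in sym_digraph) adj_sym: "u \<rightarrow> w \<Longrightarrow> w \<rightarrow> u"
  using sym_arcs by (auto simp: symmetric_def elim: symE)

text \<open>\<open>connected\<close> refers to reachability in the symmetric closure. Since arcs of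
  \<open>G\<close> come in both directions, this is already reachability in
  \<open>G \<restriction> A\<close> itself, which the inductions along paths need.\<close>

lemma (in sym_digraph) strongly_connected_induceD:
  assumes "Digraph_Component.connected (G \<restriction> A)"
  shows "strongly_connected (G \<restriction> A)"
proof -
  interpret H: wf_digraph "G \<restriction> A" by (rule wellformed_induce_subgraph)
  have "symmetric (G \<restriction> A)"
    unfolding symmetric_def using adj_sym by (auto intro!: symI simp: adj_induce_iff)
  then show ?thesis
    using assms by (rule H.symmetric_connected_imp_strongly_connected)
qed

text \<open>A path inside \<open>A\<close> starting at \<open>v\<close> can never leave
  \<open>B\<close>. This serves both for the maximality of the pivot's component and, with
  \<open>A = verts G\<close>, for the nonemptiness of neighbourhoods.\<close>

lemma (in sym_digraph) connected_subset_closed: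
  assumes conn: "Digraph_Component.connected (G \<restriction> A)" and "v \<in> A" "v \<in> B"
    and closed: "\<And>u w. u \<in> B \<Longrightarrow> u \<in> A \<Longrightarrow> w \<in> A \<Longrightarrow> u \<rightarrow> w \<Longrightarrow> w \<in> B"
  shows "A \<subseteq> B"
proof
  interpret H: wf_digraph "G \<restriction> A" by (rule wellformed_induce_subgraph)
  fix x assume "x \<in> A"
  then have "v \<rightarrow>\<^sup>*\<^bsub>G \<restriction> A\<^esub> x"
    using strongly_connected_induceD[OF conn] \<open>v \<in> A\<close> by (auto simp: strongly_connected_def)
  then show "x \<in> B"
  proof (induction rule: H.reachable_induct)
    case base
    show ?case by fact
  next
    case (step x y)
    then show ?case using closed[of x y] by (simp add: adj_induce_iff)
  qed
qed

lemma (in sym_digraph) connected_induce_Un_nbhd: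
  assumes conn: "Digraph_Component.connected (G \<restriction> B)" and S: "S \<subseteq> nbhd G B"
  shows "Digraph_Component.connected (G \<restriction> (B \<union> S))"
proof -
  let ?H = "G \<restriction> (B \<union> S)"
  interpret H: wf_digraph ?H by (rule wellformed_induce_subgraph)
  interpret HB: wf_digraph "G \<restriction> B" by (rule wellformed_induce_subgraph)
  have sc: "strongly_connected (G \<restriction> B)" by (rule strongly_connected_induceD[OF conn])
  have BB: "a \<rightarrow>\<^sup>*\<^bsub>?H\<^esub> b" if "a \<in> B" "b \<in> B" for a b
  proof -
    have "a \<rightarrow>\<^sup>*\<^bsub>G \<restriction> B\<^esub> b" using sc that by (auto simp: strongly_connected_def)
    then show ?thesis
    proof (induction rule: HB.reachable_induct)
      case base
      then show ?case by (auto intro: H.reachable_refl)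
    next
      case (step x y)
      then show ?case by (auto intro: H.reachable_adj_trans simp: adj_induce_iff)
    qed
  qed
  \<comment> \<open>Each vertex of \<open>S\<close> hangs on \<open>B\<close> by an edge, so any two
    vertices can be joined by a route through \<open>B\<close>.\<close>
  have near: "\<exists>b\<in>B. x \<rightarrow>\<^sup>*\<^bsub>?H\<^esub> b \<and> b \<rightarrow>\<^sup>*\<^bsub>?H\<^esub> x" if "x \<in> B \<union> S" for x
  proof (cases "x \<in> B")
    case True
    then show ?thesis using BB by blast
  next
    case False
    with that S obtain b where "b \<in> B" "x \<rightarrow> b" by (auto simp: nbhd_def)
    with that have "x \<rightarrow>\<^bsub>?H\<^esub> b" "b \<rightarrow>\<^bsub>?H\<^esub> x" by (auto simp: adj_induce_iff adj_sym)
    then show ?thesis using \<open>b \<in> B\<close> H.reachable_adjI by blast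
  qed
  show ?thesis
  proof (rule H.connectedI)
    show "verts ?H \<noteq> {}" using sc by (auto simp: strongly_connected_def)
    fix x y assume "x \<in> verts ?H" "y \<in> verts ?H"
    then obtain a b where "a \<in> B" "b \<in> B" "x \<rightarrow>\<^sup>*\<^bsub>?H\<^esub> a" "b \<rightarrow>\<^sup>*\<^bsub>?H\<^esub> y"
      using near[of x] near[of y] by auto
    then have "x \<rightarrow>\<^sup>*\<^bsub>?H\<^esub> y" using BB H.reachable_trans by metis
    then show "x \<rightarrow>\<^sup>*\<^bsub>mk_symmetric ?H\<^esub> y" by (rule H.reachable_mk_symmetricI)
  qed
qed

lemma (in wf_digraph) connected_induce_singleton:
  "Digraph_Component.connected (G \<restriction> {v})"
proof -
  interpret H: wf_digraph "G \<restriction> {v}" by (rule wellformed_induce_subgraph)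
  show ?thesis by (rule H.connectedI) (auto intro: H.reachable_mk_symmetricI)
qed

text \<open>If no edge left \<open>B\<close>, it would be closed under adjacency and hence contain
  everything reachable from \<open>v\<close>.\<close>

lemma (in sym_digraph) nbhd_nonempty:
  assumes "Digraph_Component.connected G" "v \<in> B" "B \<subset> verts G"
  shows "nbhd G B \<noteq> {}"
proof
  assume "nbhd G B = {}"
  then have "verts G \<subseteq> B"
    using assms by (intro connected_subset_closed[of _ v])
      (auto simp: induce_verts_self nbhd_def dest: adj_sym)
  with assms show False by auto
qed

text \<open>
  The last conjunct makes \<open>B\<close> the whole component of the pivot: on \<open>N(B)\<close>, the current colouring
  \<open>\<omega>'\<close> agrees with the initial one.
\<close>
definition flood_state ::
  "('a, 'b) pre_digraph \<Rightarrow> 'a \<Rightarrow> ('a \<Rightarrow> 'c) \<Rightarrow> ('a \<Rightarrow> 'c) \<Rightarrow> 'a set \<Rightarrow> 'c \<Rightarrow> bool" where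
  "flood_state G v \<omega> \<omega>' B c \<longleftrightarrow>
     B \<subseteq> verts G \<and> v \<in> B \<and> Digraph_Component.connected (G \<restriction> B) \<and>
     (\<forall>u\<in>B. \<omega>' u = c) \<and> (\<forall>u\<in>verts G - B. \<omega>' u = \<omega> u) \<and> (\<forall>w\<in>nbhd G B. \<omega> w \<noteq> c)"

lemma (in sym_digraph) flood_state_init:
  assumes "v \<in> verts G" "proper_colouring G \<omega>"
  shows "flood_state G v \<omega> \<omega> {v} (\<omega> v)"
  using assms connected_induce_singleton
  by (auto simp: flood_state_def proper_colouring_def nbhd_def)

text \<open>A monochromatic connected set through \<open>v\<close> has colour \<open>c\<close>, and
  to leave \<open>B\<close> it would have to enter \<open>nbhd G B\<close>, where \<open>c\<close>
  does not occur. So \<open>B\<close> is the greatest such set, which gives existence and uniqueness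
  of the component at once.\<close>

lemma (in sym_digraph) flood_state_mono_component_iff:
  assumes st: "flood_state G v \<omega> \<omega>' B c"
  shows "mono_component G \<omega>' A \<and> v \<in> A \<longleftrightarrow> A = B"
proof -
  have B: "B \<subseteq> verts G" "v \<in> B" "Digraph_Component.connected (G \<restriction> B)"
    "\<And>u. u \<in> B \<Longrightarrow> \<omega>' u = c" "\<And>u. u \<in> verts G - B \<Longrightarrow> \<omega>' u = \<omega> u"
    "\<And>w. w \<in> nbhd G B \<Longrightarrow> \<omega> w \<noteq> c"
    using st by (auto simp: flood_state_def)
  have sub: "D \<subseteq> B" if D: "mono_connected G \<omega>' D" "v \<in> D" for D
  proof (rule connected_subset_closed[of D v])
    show "Digraph_Component.connected (G \<restriction> D)" using D by (simp add: mono_connected_def)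
    fix u w assume uw: "u \<in> B" "u \<in> D" "w \<in> D" "u \<rightarrow> w"
    show "w \<in> B"
    proof (rule ccontr)
      assume "w \<notin> B"
      with uw D have w: "w \<in> nbhd G B"
        by (auto simp: nbhd_def mono_connected_def dest: adj_sym)
      then have "\<omega>' w \<noteq> c" using B(5,6)[of w] by (auto simp: nbhd_def)
      moreover have "\<omega>' w = \<omega>' u" using D uw by (metis mono_connected_def)
      ultimately show False using B(4) uw by auto
    qed
  qed (use D B in auto)
  have mc: "mono_connected G \<omega>' B" using B by (auto simp: mono_connected_def)
  then show ?thesis
    using sub \<open>v \<in> B\<close> unfolding mono_component_def by blast
qed

lemma (in sym_digraph) flood_state_move:
  assumes st: "flood_state G v \<omega> \<omega>' B c" and proper: "proper_colouring G \<omega>"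
  shows "flood_state G v \<omega> (flood_move G v d \<omega>') (B \<union> {w \<in> nbhd G B. \<omega> w = d}) d"
proof -
  \<comment> \<open>Only \<open>B\<close> is recoloured. The absorbed neighbours keep their colour,
    which is their initial one and equals \<open>d\<close>.\<close>
  have mv: "flood_move G v d \<omega>' u = (if u \<in> B then d else \<omega>' u)" for u
    using flood_state_mono_component_iff[OF st] by (auto simp: flood_move_def)
  have "Digraph_Component.connected (G \<restriction> (B \<union> {w \<in> nbhd G B. \<omega> w = d}))"
    using st by (intro connected_induce_Un_nbhd) (auto simp: flood_state_def)
  then show ?thesis
    using st proper unfolding flood_state_def
    by (auto simp: mv nbhd_def proper_colouring_def) metis
qed

text \<open>The neighbourhood bound is available at every move because \<open>flood_state\<close>
  keeps \<open>B\<close> connected and containing \<open>v\<close>. The induction varies the current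
  state, since each move replaces it.\<close>

lemma (in sym_digraph) flood_state_fold:
  assumes proper: "proper_colouring G \<omega>" and fin: "finite (verts G)"
    and nbhd_le: "\<And>A. A \<subseteq> verts G \<Longrightarrow> v \<in> A \<Longrightarrow> Digraph_Component.connected (G \<restriction> A)
      \<Longrightarrow> card (nbhd G A) \<le> s"
    and st: "flood_state G v \<omega> \<omega>' B c"
  shows "\<exists>B' c'. flood_state G v \<omega> (fold (flood_move G v) ds \<omega>') B' c'
    \<and> card B' \<le> card B + s * length ds"
  using st
proof (induction ds arbitrary: \<omega>' B c)
  case Nil
  then show ?case by auto
next
  case (Cons d ds)
  let ?B = "B \<union> {w \<in> nbhd G B. \<omega> w = d}"
  have "finite (nbhd G B)" using fin by (auto simp: nbhd_def)
  then have "card {w \<in> nbhd G B. \<omega> w = d} \<le> card (nbhd G B)" by (intro card_mono) auto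
  also have "\<dots> \<le> s" using Cons.prems by (intro nbhd_le) (auto simp: flood_state_def)
  finally have "card ?B \<le> card B + s"
    using card_Un_le[of B "{w \<in> nbhd G B. \<omega> w = d}"] by linarith
  with Cons.IH[OF flood_state_move[OF Cons.prems proper, of d]] show ?case
    by fastforce
qed

text \<open>A neighbour of a smaller \<open>B\<close> would still differ in colour from the
  pivot.\<close>

lemma (in sym_digraph) flood_state_floods_to:
  assumes "Digraph_Component.connected G" "flood_state G v \<omega> \<omega>' B c"
    and mono: "\<forall>u\<in>verts G. \<omega>' u = d"
  shows "B = verts G"
proof (rule ccontr)
  assume "B \<noteq> verts G"
  then obtain w where w: "w \<in> nbhd G B"
    using nbhd_nonempty[of v B] assms by (auto simp: flood_state_def)
  then have "\<omega>' w \<noteq> c" "w \<in> verts G" using assms by (auto simp: flood_state_def nbhd_def)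
  moreover have "\<omega>' v = c" "v \<in> verts G" using assms by (auto simp: flood_state_def)
  ultimately show False using mono by auto
qed

text \<open>This ensures that the \<open>LEAST\<close> in \<open>min_moves_to\<close> is attained.
  The moves are greedy: play the colour of some neighbour of \<open>B\<close> until \<open>B\<close>
  is everything, then play \<open>d\<close>.\<close>

lemma (in sym_digraph) flood_state_floodable:
  assumes conn: "Digraph_Component.connected G" and fin: "finite (verts G)"
    and proper: "proper_colouring G \<omega>" and col: "\<omega> ` verts G \<subseteq> C" and "d \<in> C"
    and st: "flood_state G v \<omega> \<omega>' B c"
  shows "\<exists>ds. set ds \<subseteq> C \<and> floods_to G v \<omega>' ds d"
  using st
proof (induction "card (verts G - B)" arbitrary: \<omega>' B c rule: less_induct)
  case less
  show ?case
  proof (cases "B = verts G")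
    case True
    then have "floods_to G v \<omega>' [d] d"
      using flood_state_move[OF less.prems proper, of d]
      by (auto simp: floods_to_def flood_state_def)
    then show ?thesis using \<open>d \<in> C\<close> by (intro exI[of _ "[d]"]) auto
  next
    case False
    then obtain w where w: "w \<in> nbhd G B"
      using nbhd_nonempty[of v B] conn less.prems by (auto simp: flood_state_def)
    let ?B = "B \<union> {x \<in> nbhd G B. \<omega> x = \<omega> w}"
    \<comment> \<open>The decrease is strict because \<open>w\<close> itself is absorbed.\<close>
    have "card (verts G - ?B) < card (verts G - B)"
      using fin w by (intro psubset_card_mono) (auto simp: nbhd_def)
    from less.hyps[OF this flood_state_move[OF less.prems proper]]
    obtain ds where "set ds \<subseteq> C" "floods_to G v (flood_move G v (\<omega> w) \<omega>') ds d" by blast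
    then show ?thesis
      using w col by (intro exI[of _ "\<omega> w # ds"]) (auto simp: floods_to_def nbhd_def)
  qed
qed

theorem proposition2p5:
  fixes G :: "('a, 'b) pre_digraph" and C :: "'c set" and \<omega> :: "'a \<Rightarrow> 'c"
    and v :: 'a and n s :: nat
  assumes "graph G"
    and "Digraph_Component.connected G"
    and "card (verts G) = n"
    and "n \<ge> 1"
    and "v \<in> verts G"
    and "finite C"
    and "\<omega> ` verts G \<subseteq> C"
    and "proper_colouring G \<omega>"
    and "s \<ge> 1"
    and "\<And>A. A \<subseteq> verts G \<Longrightarrow> v \<in> A \<Longrightarrow> Digraph_Component.connected (G \<restriction> A) \<Longrightarrow> card (nbhd G A) \<le> s"
  shows "real (min_moves G C v \<omega>) \<ge> (1 / real s) * (real n - 1)"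
proof -
  interpret graph G by fact
  note init = flood_state_init[OF assms(5,8)]
  \<comment> \<open>The minimum is attained: \<open>C\<close> is finite, and it is nonempty because
    it contains \<open>\<omega> v\<close>.\<close>
  have "min_moves G C v \<omega> \<in> min_moves_to G C v \<omega> ` C"
    unfolding min_moves_def using assms(5,6,7) by (intro Min_in) auto
  then obtain d where d: "d \<in> C" "min_moves G C v \<omega> = min_moves_to G C v \<omega> d" by auto
  have "\<exists>k ds. set ds \<subseteq> C \<and> length ds = k \<and> floods_to G v \<omega> ds d"
    using flood_state_floodable[OF assms(2) finite_verts assms(8,7) d(1) init] by blast
  from LeastI_ex[OF this] obtain ds
    where ds: "length ds = min_moves G C v \<omega>" "floods_to G v \<omega> ds d"
    unfolding d(2) min_moves_to_def by auto
  \<comment> \<open>The starting component \<open>{v}\<close> contributes the 1 that is subtracted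
    from \<open>n\<close> in the bound.\<close>
  obtain B c where B: "flood_state G v \<omega> (fold (flood_move G v) ds \<omega>) B c"
    "card B \<le> card {v} + s * length ds"
    using flood_state_fold[OF assms(8) finite_verts assms(10) init] by blast
  have "B = verts G"
    using ds(2) unfolding floods_to_def by (rule flood_state_floods_to[OF assms(2) B(1)])
  with B(2) ds(1) assms(3) have "n \<le> 1 + s * min_moves G C v \<omega>" by simp
  then have "real n \<le> 1 + real s * real (min_moves G C v \<omega>)"
    by (metis of_nat_1 of_nat_add of_nat_le_iff of_nat_mult)
  then show ?thesis using assms(9) by (simp add: field_simps)
qed

end
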